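(* Any $1$-dimensional complex triassociative algebra is isomorphic to one of the following pairwise non-isomorphic triassociative algebras with basis $\{x\}$ (products not listed are zero): (1) $T_1^1$: abelian (all products zero); (2) $T_1^2$: $x\perp x=x$; (3) $T_1^3$: $x\vdash x=x\dashv x=x\perp x=x$.
   Context: A complex triassociative algebra $(T,\vdash,\dashv,\perp)$ is a complex vector space $T$ with three bilinear products $\vdash,\dashv,\perp:T\times T\to T$ satisfying, for all $x,y,z\in T$: (A1) $(x\vdash y)\vdash z=x\vdash(y\vdash z)$; (A2) $(x\dashv y)\dashv z=x\dashv(y\dashv z)$; (D1) $(x\dashv y)\vdash z=x\vdash(y\vdash z)$; (D2) $(x\dashv y)\dashv z=x\dashv(y\vdash z)$; (S1) $(x\vdash y)\dashv z=x\vdash(y\dashv z)$; (T1) $(x\perp y)\vdash z=x\vdash(y\vdash z)$; (T2) $(x\dashv y)\dashv z=x\dashv(y\perp z)$; (T3) $(x\vdash y)\perp z=x\vdash(y\perp z)$; (T4) $(x\perp y)\dashv z=x\perp(y\dashv z)$; (S2) $(x\dashv y)\perp z=x\perp(y\vdash z)$; (A3) $(x\perp y)\perp z=x\perp(y\perp z)$. A homomorphism of triassociative algebras is a linear map $\phi$ with $\phi(x\ast y)=\phi(x)\ast\phi(y)$ for each $\ast\in\{\vdash,\dashv,\perp\}$; an isomorphism is a bijective homomorphism. *)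

theory Defs
  imports Complex_Main
begin

text \<open>
  The underlying vector space is the whole type \<open>'a\<close>, with its additive group structure
  and the scalar multiplication \<open>scale\<close>.
\<close>

record 'a trialg =
  scale :: "complex \<Rightarrow> 'a \<Rightarrow> 'a"
  lprod :: "'a \<Rightarrow> 'a \<Rightarrow> 'a"  (infixl "\<turnstile>\<index>" 70)
  rprod :: "'a \<Rightarrow> 'a \<Rightarrow> 'a"  (infixl "\<stileturn>\<index>" 70)
  mprod :: "'a \<Rightarrow> 'a \<Rightarrow> 'a"  (infixl "\<bottom>\<index>" 70)

definition bilinear_product ::
    "(complex \<Rightarrow> 'a \<Rightarrow> 'a) \<Rightarrow> ('a::ab_group_add \<Rightarrow> 'a \<Rightarrow> 'a) \<Rightarrow> bool" where
  "bilinear_product s m \<longleftrightarrow>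
     (\<forall>y. Vector_Spaces.linear s s (\<lambda>x. m x y)) \<and>
     (\<forall>x. Vector_Spaces.linear s s (\<lambda>y. m x y))"

locale triassociative_algebra =
  vector_space "scale T" for T :: "'a::ab_group_add trialg" (structure) +
  assumes bilinear_l: "bilinear_product (scale T) (lprod T)"
    and bilinear_r: "bilinear_product (scale T) (rprod T)"
    and bilinear_m: "bilinear_product (scale T) (mprod T)"
    and A1: "(x \<turnstile> y) \<turnstile> z = x \<turnstile> (y \<turnstile> z)"
    and A2: "(x \<stileturn> y) \<stileturn> z = x \<stileturn> (y \<stileturn> z)"
    and D1: "(x \<stileturn> y) \<turnstile> z = x \<turnstile> (y \<turnstile> z)"
    and D2: "(x \<stileturn> y) \<stileturn> z = x \<stileturn> (y \<turnstile> z)"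
    and S1: "(x \<turnstile> y) \<stileturn> z = x \<turnstile> (y \<stileturn> z)"
    and T1: "(x \<bottom> y) \<turnstile> z = x \<turnstile> (y \<turnstile> z)"
    and T2: "(x \<stileturn> y) \<stileturn> z = x \<stileturn> (y \<bottom> z)"
    and T3: "(x \<turnstile> y) \<bottom> z = x \<turnstile> (y \<bottom> z)"
    and T4: "(x \<bottom> y) \<stileturn> z = x \<bottom> (y \<stileturn> z)"
    and S2: "(x \<stileturn> y) \<bottom> z = x \<bottom> (y \<turnstile> z)"
    and A3: "(x \<bottom> y) \<bottom> z = x \<bottom> (y \<bottom> z)"

definition trialg_hom ::
    "'a::ab_group_add trialg \<Rightarrow> 'b::ab_group_add trialg \<Rightarrow> ('a \<Rightarrow> 'b) \<Rightarrow> bool" where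
  "trialg_hom S T \<phi> \<longleftrightarrow>
     Vector_Spaces.linear (scale S) (scale T) \<phi> \<and>
     (\<forall>x y. \<phi> (x \<turnstile>\<^bsub>S\<^esub> y) = \<phi> x \<turnstile>\<^bsub>T\<^esub> \<phi> y) \<and>
     (\<forall>x y. \<phi> (x \<stileturn>\<^bsub>S\<^esub> y) = \<phi> x \<stileturn>\<^bsub>T\<^esub> \<phi> y) \<and>
     (\<forall>x y. \<phi> (x \<bottom>\<^bsub>S\<^esub> y) = \<phi> x \<bottom>\<^bsub>T\<^esub> \<phi> y)"

definition trialg_isomorphic ::
    "'a::ab_group_add trialg \<Rightarrow> 'b::ab_group_add trialg \<Rightarrow> bool" where
  "trialg_isomorphic S T \<longleftrightarrow> (\<exists>\<phi>. trialg_hom S T \<phi> \<and> bij \<phi>)"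

text \<open>The library sets \<open>dim = 0\<close> in infinite dimension, so \<open>dim = 1\<close> is genuine.\<close>

definition one_dim_trialg :: "'a::ab_group_add trialg \<Rightarrow> bool" where
  "one_dim_trialg T \<longleftrightarrow>
     triassociative_algebra T \<and> vector_space.dim (scale T) UNIV = 1"

text \<open>
  The products on the complex line with basis vector \<open>x = 1\<close> that are determined by
  bilinearity from \<open>x \<turnstile> x = l x\<close>, \<open>x \<stileturn> x = r x\<close>, \<open>x \<bottom> x = m x\<close>.
\<close>

definition line_trialg :: "complex \<Rightarrow> complex \<Rightarrow> complex \<Rightarrow> complex trialg" where
  "line_trialg l r m =
     \<lparr> scale = (*), lprod = (\<lambda>a b. a * b * l), rprod = (\<lambda>a b. a * b * r),
       mprod = (\<lambda>a b. a * b * m) \<rparr>"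

definition T11 :: "complex trialg" where "T11 = line_trialg 0 0 0"
definition T12 :: "complex trialg" where "T12 = line_trialg 0 0 1"
definition T13 :: "complex trialg" where "T13 = line_trialg 1 1 1"

end

theory Submission
  imports Defs
begin

text \<open>
  In a one-dimensional algebra each product is determined by a single complex number: if
  \<open>e\<close> spans, then \<open>e \<turnstile> e = l e\<close>, \<open>e \<stileturn> e = r e\<close> and \<open>e \<bottom> e = m e\<close>. On a line, an identity of
  degree three is just a quadratic equation between \<open>l\<close>, \<open>r\<close> and \<open>m\<close>, and the eleven axioms
  together say no more than \<open>r = l\<close> and \<open>l = 0 \<or> m = l\<close> (lemmas
  \<open>structure_constants_relations\<close> and \<open>one_dim_line_trialg\<close>): the equations
  \<open>r l = l\<^sup>2\<close> of (D1) and \<open>r\<^sup>2 = l r\<close> of (D2) say that \<open>r - l\<close> annihilates both \<open>l\<close> and \<open>r\<close>,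
  which forces \<open>r = l\<close>, and (T1) reads \<open>m l = l\<^sup>2\<close>.

  Replacing \<open>e\<close> by \<open>c e\<close> multiplies all three constants by \<open>c\<close>. Hence the only invariant is
  the triple \<open>(l, r, m)\<close> up to a common nonzero factor. A triple \<open>(l, l, l)\<close> with \<open>l \<noteq> 0\<close>
  normalises to \<open>(1, 1, 1)\<close>, a triple \<open>(0, 0, m)\<close> with \<open>m \<noteq> 0\<close> to \<open>(0, 0, 1)\<close>, and the zero
  triple stays alone; as \<open>(0, 0, 0)\<close>, \<open>(0, 0, 1)\<close> and \<open>(1, 1, 1)\<close> are not proportional with a
  nonzero factor, the three algebras are pairwise non-isomorphic.
\<close>

lemma line_trialg_simps [simp]:
  "scale (line_trialg l r m) = (*)"
  "a \<turnstile>\<^bsub>line_trialg l r m\<^esub> b = a * b * l"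
  "a \<stileturn>\<^bsub>line_trialg l r m\<^esub> b = a * b * r"
  "a \<bottom>\<^bsub>line_trialg l r m\<^esub> b = a * b * m"
  by (simp_all add: line_trialg_def)

lemma vector_space_complex_line: "vector_space ((*) :: complex \<Rightarrow> complex \<Rightarrow> complex)"
  by unfold_locales (auto simp: algebra_simps)

lemma dim_complex_line: "vector_space.dim ((*) :: complex \<Rightarrow> complex \<Rightarrow> complex) UNIV = 1"
proof -
  interpret V: vector_space "(*) :: complex \<Rightarrow> complex \<Rightarrow> complex"
    by (rule vector_space_complex_line)
  have "V.independent {1}"
    by simp
  moreover have "UNIV \<subseteq> V.span {1}"
    by (auto simp: V.span_singleton)
  ultimately show ?thesis
    by (intro V.dim_unique[of "{1}"]) auto
qed

lemma bilinear_product_complex_line: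
  "bilinear_product (*) (\<lambda>a b. a * b * c)" for c :: complex
  unfolding bilinear_product_def Vector_Spaces.linear_iff
  by (auto simp: vector_space_complex_line algebra_simps)

lemma one_dim_line_trialg:
  assumes "r = l" and "l = 0 \<or> m = l"
  shows "one_dim_trialg (line_trialg l r m)"
  unfolding one_dim_trialg_def
proof
  show "triassociative_algebra (line_trialg l r m)"
    unfolding triassociative_algebra_def triassociative_algebra_axioms_def
    using assms
    by (auto simp: vector_space_complex_line bilinear_product_complex_line line_trialg_def)
  show "vector_space.dim (scale (line_trialg l r m)) UNIV = 1"
    by (simp add: dim_complex_line)
qed

lemma bilinear_product_scale:
  assumes "bilinear_product s p"
  shows "p (s a x) y = s a (p x y)" and "p x (s a y) = s a (p x y)"
  using assms by (simp_all add: bilinear_product_def Vector_Spaces.linear_iff)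

text \<open>
  The inverse of the coordinate map \<open>k \<mapsto> k e\<close> is an isomorphism, since both sides multiply
  coordinates and then apply the constant.
\<close>

lemma (in triassociative_algebra) isomorphic_line_trialg:
  assumes "e \<noteq> 0" and spans: "range (\<lambda>k. scale T k e) = UNIV"
    and l: "e \<turnstile> e = scale T l e" and r: "e \<stileturn> e = scale T r e" and m: "e \<bottom> e = scale T m e"
  shows "trialg_isomorphic T (line_trialg l r m)"
proof -
  define \<psi> where "\<psi> = (\<lambda>k. scale T k e)"
  define \<phi> where "\<phi> = inv \<psi>"
  have bij: "bij \<psi>"
    using assms(1) spans by (auto simp: bij_def inj_def \<psi>_def)
  have \<phi>: "\<phi> (scale T k e) = k" for k
    using bij unfolding \<phi>_def by (metis \<psi>_def bij_inv_eq_iff)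
  have coord: "\<exists>k. x = scale T k e" for x
    using spans by (metis rangeE UNIV_I)
  have add: "\<phi> (x + y) = \<phi> x + \<phi> y" for x y
    using coord[of x] coord[of y] \<phi> by (metis scale_left_distrib)
  have scl: "\<phi> (scale T c x) = c * \<phi> x" for c x
    using coord[of x] \<phi> by (metis scale_scale)
  have "Vector_Spaces.linear (scale T) (*) \<phi>"
    by (auto simp: Vector_Spaces.linear_iff vector_space_complex_line vector_space_axioms add scl)
  moreover have prod: "\<phi> (p x y) = \<phi> x * \<phi> y * c"
    if p: "bilinear_product (scale T) p" and c: "p e e = scale T c e" for p c x y
  proof -
    obtain a b where "x = scale T a e" "y = scale T b e"
      using coord by blast
    moreover have "\<phi> e = 1"
      using \<phi>[of 1] by simp
    ultimately show ?thesis
      by (simp add: bilinear_product_scale[OF p] c scl)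
  qed
  ultimately have "trialg_hom T (line_trialg l r m) \<phi>"
    using prod[OF bilinear_l l] prod[OF bilinear_r r] prod[OF bilinear_m m]
    by (simp add: trialg_hom_def)
  then show ?thesis
    using bij bij_imp_bij_inv unfolding trialg_isomorphic_def \<phi>_def by blast
qed

text \<open>
  Passing to the basis vector \<open>k\<inverse> e\<close> divides the structure constants by \<open>k\<close>.
\<close>

lemma (in triassociative_algebra) isomorphic_line_trialg_rescaled:
  assumes "k \<noteq> 0" and "e \<noteq> 0" and spans: "range (\<lambda>k. scale T k e) = UNIV"
    and l: "e \<turnstile> e = scale T l e" and r: "e \<stileturn> e = scale T r e" and m: "e \<bottom> e = scale T m e"
  shows "trialg_isomorphic T (line_trialg (l / k) (r / k) (m / k))"
proof (rule isomorphic_line_trialg)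
  let ?f = "scale T (inverse k) e"
  show "?f \<noteq> 0"
    using assms by simp
  have "scale T a e = scale T (a * k) ?f" for a
    using assms(1) by simp
  then show "range (\<lambda>k. scale T k ?f) = UNIV"
    using spans by (metis (no_types, lifting) UNIV_I UNIV_eq_I image_iff)
  show "?f \<turnstile> ?f = scale T (l / k) ?f"
    by (simp add: bilinear_product_scale[OF bilinear_l] l field_simps)
  show "?f \<stileturn> ?f = scale T (r / k) ?f"
    by (simp add: bilinear_product_scale[OF bilinear_r] r field_simps)
  show "?f \<bottom> ?f = scale T (m / k) ?f"
    by (simp add: bilinear_product_scale[OF bilinear_m] m field_simps)
qed

lemma (in triassociative_algebra) structure_constants_relations:
  assumes "e \<noteq> 0"
    and l: "e \<turnstile> e = scale T l e" and r: "e \<stileturn> e = scale T r e" and m: "e \<bottom> e = scale T m e"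
  shows "r = l" and "l = 0 \<or> m = l"
proof -
  note scl = bilinear_product_scale[OF bilinear_l] bilinear_product_scale[OF bilinear_r]
    bilinear_product_scale[OF bilinear_m]
  have "r * l = l * l"
    using D1[of e e e] assms(1) by (simp add: l r scl)
  moreover have "r * r = l * r"
    using D2[of e e e] assms(1) by (simp add: l r scl)
  ultimately show "r = l"
    by auto
  have "m * l = l * l"
    using T1[of e e e] assms(1) by (simp add: l m scl)
  then show "l = 0 \<or> m = l"
    by simp
qed

lemma (in vector_space) dim_one_obtain_spanning_vector:
  assumes "dim UNIV = 1"
  obtains e where "e \<noteq> 0" and "range (\<lambda>k. scale k e) = UNIV"
proof -
  obtain B where B: "independent B" "UNIV \<subseteq> span B" "card B = 1"
    using basis_exists[of UNIV] assms by metis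
  then obtain e where "B = {e}"
    by (auto simp: card_1_singleton_iff)
  with B that show thesis
    by (auto simp: span_singleton)
qed

lemma one_dim_trialg_classification:
  fixes T (structure)
  assumes "one_dim_trialg T"
  shows "trialg_isomorphic T T11 \<or> trialg_isomorphic T T12 \<or> trialg_isomorphic T T13"
proof -
  interpret triassociative_algebra T
    using assms by (simp add: one_dim_trialg_def)
  have "dim UNIV = 1"
    using assms by (simp add: one_dim_trialg_def)
  then obtain e where e: "e \<noteq> 0" and spans: "range (\<lambda>k. scale T k e) = UNIV"
    by (rule dim_one_obtain_spanning_vector)
  have "\<exists>k. x = scale T k e" for x
    using spans by (metis rangeE UNIV_I)
  then obtain l r m where lrm: "e \<turnstile> e = scale T l e" "e \<stileturn> e = scale T r e" "e \<bottom> e = scale T m e"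
    by blast
  have rl: "r = l" and lm: "l = 0 \<or> m = l"
    using structure_constants_relations[OF e lrm] by blast+
  note rescaled = isomorphic_line_trialg_rescaled[OF _ e spans lrm]
  consider "l \<noteq> 0" | "l = 0" "m \<noteq> 0" | "l = 0" "m = 0"
    by blast
  then show ?thesis
  proof cases
    case 1
    with rescaled[of l] rl lm show ?thesis
      by (simp add: T13_def)
  next
    case 2
    with rescaled[of m] rl show ?thesis
      by (simp add: T12_def)
  next
    case 3
    with rescaled[of 1] rl show ?thesis
      by (simp add: T11_def)
  qed
qed

text \<open>
  An isomorphism is multiplication by its value \<open>c\<close> at the basis vector \<open>1\<close>, and comparing
  the images of the squares of \<open>1\<close> gives \<open>c l = c\<^sup>2 l'\<close>, and likewise for the other products.
\<close>

lemma isomorphic_line_trialg_proportional: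
  assumes "trialg_isomorphic (line_trialg l r m) (line_trialg l' r' m')"
  obtains c where "c \<noteq> 0" "l = c * l'" "r = c * r'" "m = c * m'"
proof -
  let ?S = "line_trialg l r m" and ?T = "line_trialg l' r' m'"
  obtain \<phi> where hom: "trialg_hom ?S ?T \<phi>" and bij: "bij \<phi>"
    using assms by (auto simp: trialg_isomorphic_def)
  have "\<phi> (k * x) = k * \<phi> x" for k x
    using hom by (simp add: trialg_hom_def Vector_Spaces.linear_iff)
  then have \<phi>: "\<phi> k = k * \<phi> 1" for k
    by (metis mult.right_neutral)
  have ne: "\<phi> 1 \<noteq> 0"
    using bij \<phi>[of 0] by (metis bij_def injD mult_zero_left zero_neq_one)
  have "\<phi> l = \<phi> 1 * \<phi> 1 * l'" "\<phi> r = \<phi> 1 * \<phi> 1 * r'" "\<phi> m = \<phi> 1 * \<phi> 1 * m'"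
    using hom unfolding trialg_hom_def line_trialg_simps by (metis mult_1)+
  then have "l = \<phi> 1 * l'" "r = \<phi> 1 * r'" "m = \<phi> 1 * m'"
    using \<phi>[of l] \<phi>[of r] \<phi>[of m] ne by simp_all
  with ne that show thesis
    by blast
qed

theorem theorem3p4:
  "(\<forall>T :: 'a::ab_group_add trialg. one_dim_trialg T \<longrightarrow>
      trialg_isomorphic T T11 \<or> trialg_isomorphic T T12 \<or> trialg_isomorphic T T13) \<and>
   one_dim_trialg T11 \<and> one_dim_trialg T12 \<and> one_dim_trialg T13 \<and>
   \<not> trialg_isomorphic T11 T12 \<and> \<not> trialg_isomorphic T11 T13 \<and> \<not> trialg_isomorphic T12 T13"
proof (intro conjI)
  show "\<forall>T :: 'a trialg. one_dim_trialg T \<longrightarrow>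
      trialg_isomorphic T T11 \<or> trialg_isomorphic T T12 \<or> trialg_isomorphic T T13"
    using one_dim_trialg_classification by blast
  show "one_dim_trialg T11" "one_dim_trialg T12" "one_dim_trialg T13"
    by (simp_all add: T11_def T12_def T13_def one_dim_line_trialg)
  show "\<not> trialg_isomorphic T11 T12" "\<not> trialg_isomorphic T11 T13" "\<not> trialg_isomorphic T12 T13"
    unfolding T11_def T12_def T13_def
    by (auto elim!: isomorphic_line_trialg_proportional)
qed

end
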